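(* For every $n\geq 0$, the Hanoi-Fibonacci graph $\mathcal{F}_n$ is strongly connected; that is, any state of the Tower of Hanoi-Fibonacci with $n$ disks can be reached from any other state by a sequence of Fibonacci moves.
   Context: Disks $1,\dots,n$, $\Delta_k=\{1,\dots,k\}$ ($\varnothing$ for $k<1$). A state is an ordered triple $(A,B,C)$ of pairwise disjoint sets with union $\Delta_n$ (each peg stacked in decreasing order, top = minimum); there are $3^n$ states. For $k\in\Delta_n$, a $k$-Fibonacci move is defined when two distinct pegs $X,Y$ satisfy $X=k\tilde X$, $Y=\Delta_{k-1}\tilde Y$ (all disks of $\tilde X,\tilde Y$ larger than $k$) and the third peg $Z$ contains only disks larger than $k$; it yields $\tilde{X}\sqcup \Delta_{k-2}\tilde{Y}\sqcup (k-1)kZ$ (disks $k-1,k$ put simultaneously onto $Z$; peg positions preserved). A Fibonacci move is a $k$-Fibonacci move for some $k$. $\mathcal{F}_n$ is the directed graph whose vertices are the $3^n$ states, with an arc from $e$ to $e'$ whenever a Fibonacci move takes $e$ to $e'$. *)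

theory Defs
  imports "Graph_Theory.Graph_Theory"
begin

definition Delta :: "nat \<Rightarrow> nat set" where
  "Delta k = {1..k}"

(* A peg is given by the set of its disks: the stacking order is forced to be decreasing. *)
type_synonym hanoi_state = "nat set \<times> nat set \<times> nat set"

definition hanoi_states :: "nat \<Rightarrow> hanoi_state set" where
  "hanoi_states n =
    {(A, B, C). A \<inter> B = {} \<and> A \<inter> C = {} \<and> B \<inter> C = {} \<and> A \<union> B \<union> C = Delta n}"

datatype peg = PegA | PegB | PegC

fun disks_on :: "hanoi_state \<Rightarrow> peg \<Rightarrow> nat set" where
  "disks_on (A, B, C) PegA = A"
| "disks_on (A, B, C) PegB = B"
| "disks_on (A, B, C) PegC = C"

(* X', Y' are the parts of pegs X, Y lying below the disks k and Delta (k - 1), respectively.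
   Truncated subtraction is harmless, as Delta 0 = {}.  Intersecting with Delta k only discards
   the non-existent disk 0 when k = 1: a 1-Fibonacci move moves disk 1 alone. *)
definition k_fibonacci_move :: "nat \<Rightarrow> hanoi_state \<Rightarrow> hanoi_state \<Rightarrow> bool" where
  "k_fibonacci_move k s t \<longleftrightarrow>
    (\<exists>X Y Z X' Y'. distinct [X, Y, Z] \<and>
      disks_on s X = {k} \<union> X' \<and>
      disks_on s Y = Delta (k - 1) \<union> Y' \<and>
      (\<forall>j \<in> X' \<union> Y' \<union> disks_on s Z. k < j) \<and>
      disks_on t X = X' \<and>
      disks_on t Y = Delta (k - 2) \<union> Y' \<and>
      disks_on t Z = ({k - 1, k} \<inter> Delta k) \<union> disks_on s Z)"

definition fibonacci_move :: "nat \<Rightarrow> hanoi_state \<Rightarrow> hanoi_state \<Rightarrow> bool" where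
  "fibonacci_move n s t \<longleftrightarrow> (\<exists>k \<in> Delta n. k_fibonacci_move k s t)"

definition hanoi_fibonacci_graph :: "nat \<Rightarrow> hanoi_state pair_pre_digraph" where
  "hanoi_fibonacci_graph n =
    \<lparr> pverts = hanoi_states n,
      parcs = {(s, t). s \<in> hanoi_states n \<and> t \<in> hanoi_states n \<and> fibonacci_move n s t} \<rparr>"

end

theory Submission
  imports Defs
begin

text \<open>
  Moves with index at most \<open>k\<close> ignore the disks larger than \<open>k\<close>, so induct on \<open>k\<close>: the disks up to
  \<open>k + 1\<close> can be rearranged arbitrarily. If disk \<open>k + 1\<close> has to go from peg \<open>X\<close> to peg \<open>Z\<close>, first
  gather the disks up to \<open>k\<close> on the third peg, then perform the \<open>(k + 1)\<close>-Fibonacci move. It also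
  carries disk \<open>k\<close> to \<open>Z\<close>, but the induction hypothesis puts the smaller disks back in order.
\<close>

text \<open>Encoding a state by the peg of each disk makes disjointness and covering automatic.
  Values of \<open>f\<close> outside \<open>Delta n\<close> have no effect.\<close>

definition state_of :: "nat \<Rightarrow> (nat \<Rightarrow> peg) \<Rightarrow> hanoi_state" where
  "state_of n f =
    ({j \<in> Delta n. f j = PegA}, {j \<in> Delta n. f j = PegB}, {j \<in> Delta n. f j = PegC})"

lemma disks_on_state_of: "disks_on (state_of n f) p = {j \<in> Delta n. f j = p}"
  by (cases p) (simp_all add: state_of_def)

lemma state_of_in_hanoi_states: "state_of n f \<in> hanoi_states n"
proof -
  have "f j = PegA \<or> f j = PegB \<or> f j = PegC" for j
    by (cases "f j") auto
  then show ?thesis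
    by (auto simp: state_of_def hanoi_states_def)
qed

lemma hanoi_states_eq_range_state_of: "hanoi_states n = range (state_of n)"
proof (intro equalityI subsetI)
  fix s assume "s \<in> hanoi_states n"
  then obtain A B C where s: "s = (A, B, C)"
    and disj: "A \<inter> B = {}" "A \<inter> C = {}" "B \<inter> C = {}" and un: "A \<union> B \<union> C = Delta n"
    by (auto simp: hanoi_states_def)
  \<comment> \<open>The default \<open>PegC\<close> is right on \<open>Delta n\<close>, where a disk
    in neither \<open>A\<close> nor \<open>B\<close> lies in \<open>C\<close>.\<close>
  define f where "f = (\<lambda>j. if j \<in> A then PegA else if j \<in> B then PegB else PegC)"
  have "s = state_of n f"
    using disj by (auto simp: s state_of_def f_def simp flip: un)
  then show "s \<in> range (state_of n)"
    by blast
qed (auto simp: state_of_in_hanoi_states)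

lemma third_peg:
  obtains y :: peg where "y \<noteq> x" "y \<noteq> z"
  by (cases x; cases z) auto

text \<open>One update covers every \<open>k\<close>: if \<open>k = 1\<close>, it also changes the
  value at 0, but 0 is not a disk.\<close>

lemma k_fibonacci_move_state_of:
  assumes "k \<in> Delta n" "distinct [x, y, z]"
    and "f k = x" "\<And>j. j < k \<Longrightarrow> f j = y"
  shows "k_fibonacci_move k (state_of n f)
    (state_of n (\<lambda>j. if j = k \<or> j = k - 1 then z else f j))" (is "k_fibonacci_move k ?s ?t")
  unfolding k_fibonacci_move_def
proof (intro exI conjI)
  let ?X = "{j \<in> Delta n. k < j \<and> f j = x}" and ?Y = "{j \<in> Delta n. k < j \<and> f j = y}"
  \<comment> \<open>Keeping \<open>g\<close> opaque lets the simplifier unfold \<open>f\<close> without looping.\<close>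
  obtain g where f: "f = (\<lambda>j. if j < k then y else if j = k then x else g j)"
    using assms(3,4) by fastforce
  have k: "1 \<le> k" "k \<le> n" and neq: "x \<noteq> y" "x \<noteq> z" "y \<noteq> z"
    using assms(1,2) by (auto simp: Delta_def)
  note simps = disks_on_state_of Delta_def f
  show "distinct [x, y, z]" by fact
  show "disks_on ?s x = {k} \<union> ?X" "disks_on ?s y = Delta (k - 1) \<union> ?Y"
    using k neq by (auto simp: simps split: if_splits)
  show "disks_on ?t x = ?X" "disks_on ?t y = Delta (k - 2) \<union> ?Y"
    using k neq by (auto simp: simps split: if_splits)
  show "disks_on ?t z = ({k - 1, k} \<inter> Delta k) \<union> disks_on ?s z"
    using k neq by (auto simp: simps split: if_splits)
  show "\<forall>j \<in> ?X \<union> ?Y \<union> disks_on ?s z. k < j"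
    using k neq by (auto simp: simps split: if_splits)
qed

lemma wf_digraph_hanoi_fibonacci_graph: "wf_digraph (with_proj (hanoi_fibonacci_graph n))"
  by unfold_locales (auto simp: hanoi_fibonacci_graph_def)

lemma reachable_state_of:
  assumes "k \<le> n" "\<And>j. k < j \<Longrightarrow> f j = g j"
  shows "state_of n f \<rightarrow>\<^sup>*\<^bsub>with_proj (hanoi_fibonacci_graph n)\<^esub> state_of n g"
  using assms
proof (induction k arbitrary: f g)
  case 0
  \<comment> \<open>\<open>f\<close> and \<open>g\<close> can differ only at 0, which is not a
    disk.\<close>
  then have "state_of n f = state_of n g"
    by (auto simp: state_of_def Delta_def)
  then show ?case
    by (simp add: reachable_def hanoi_fibonacci_graph_def state_of_in_hanoi_states)
next
  case (Suc k)
  show ?case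
  proof (cases "f (Suc k) = g (Suc k)")
    case True
    with Suc show ?thesis
      by (metis Suc_leD Suc_lessI)
  next
    case False
    obtain y where y: "y \<noteq> f (Suc k)" "y \<noteq> g (Suc k)"
      by (rule third_peg)
    \<comment> \<open>\<open>h\<close> prepares the move of disk \<open>Suc k\<close>, and
      \<open>h'\<close> is its result. Above \<open>k\<close>, \<open>h\<close> agrees with
      \<open>f\<close> and \<open>h'\<close> with \<open>g\<close>, so the induction hypothesis
      applies on both sides of the move.\<close>
    define h where "h = (\<lambda>j. if j \<le> k then y else f j)"
    define h' where "h' = (\<lambda>j. if j = Suc k \<or> j = Suc k - 1 then g (Suc k) else h j)"
    have fh: "state_of n f \<rightarrow>\<^sup>*\<^bsub>with_proj (hanoi_fibonacci_graph n)\<^esub> state_of n h"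
      using Suc.prems by (intro Suc.IH) (auto simp: h_def)
    have "k_fibonacci_move (Suc k) (state_of n h) (state_of n h')"
      unfolding h'_def using Suc.prems y False
      by (intro k_fibonacci_move_state_of[where x = "f (Suc k)" and y = y])
        (auto simp: h_def Delta_def)
    then have "(state_of n h, state_of n h') \<in> parcs (hanoi_fibonacci_graph n)"
      using Suc.prems(1)
      by (auto simp: hanoi_fibonacci_graph_def fibonacci_move_def state_of_in_hanoi_states
          Delta_def intro!: bexI[of _ "Suc k"])
    then have hh': "state_of n h \<rightarrow>\<^sup>*\<^bsub>with_proj (hanoi_fibonacci_graph n)\<^esub> state_of n h'"
      by (simp add: wf_digraph.reachable_adjI[OF wf_digraph_hanoi_fibonacci_graph])
    have h'g: "state_of n h' \<rightarrow>\<^sup>*\<^bsub>with_proj (hanoi_fibonacci_graph n)\<^esub> state_of n g"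
      using Suc.prems by (intro Suc.IH) (auto simp: h_def h'_def)
    from fh hh' h'g show ?thesis
      by (blast intro: wf_digraph.reachable_trans[OF wf_digraph_hanoi_fibonacci_graph])
  qed
qed

theorem theorem2p12:
  fixes n :: nat
  shows "strongly_connected (hanoi_fibonacci_graph n)"
proof -
  have "state_of n f \<rightarrow>\<^sup>*\<^bsub>with_proj (hanoi_fibonacci_graph n)\<^esub> state_of n g" for f g
  proof -
    \<comment> \<open>\<open>reachable_state_of\<close> needs agreement beyond \<open>n\<close> too,
      so \<open>g\<close> is replaced there by \<open>f\<close>, which leaves its state
      unchanged.\<close>
    have "state_of n g = state_of n (\<lambda>j. if j \<le> n then g j else f j)"
      by (auto simp: state_of_def Delta_def)
    then show ?thesis
      using reachable_state_of[of n n f "\<lambda>j. if j \<le> n then g j else f j"] by simp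
  qed
  moreover have "pverts (hanoi_fibonacci_graph n) = range (state_of n)"
    by (simp add: hanoi_fibonacci_graph_def hanoi_states_eq_range_state_of)
  ultimately show ?thesis
    by (auto simp: strongly_connected_def)
qed

end
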